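(* Let $k\ge1$ be an integer and let $q,z\in\mathbb{C}$ with $|q|<1$ and $z\ne0$. Then $$\sum_{n_1\ge\cdots\ge n_k\ge0}\frac{(-q/z,-zq)_{n_k}\,q^{\sum_{i=1}^{k}n_i(n_i+1)}}{(q)_{n_1-n_2}\cdots(q)_{n_{k-1}-n_k}(q)_{2n_k+1}}=\frac{(-q^{2k+1}/z,-zq^{2k+1},q^{2k+1};q^{2k+1})_\infty}{(q)_\infty}.$$
   Context: $(a;p)_n=\prod_{j=1}^{n}(1-ap^{j-1})$ for $n\ge0$ (with $(a;p)_0=1$), $(a;p)_\infty=\prod_{j\ge0}(1-ap^j)$, $(a_1,\dots,a_m;p)_n=\prod_i(a_i;p)_n$ and likewise with $n=\infty$; when the base is omitted it is $q$. The sum is over integers $n_1\ge\cdots\ge n_k\ge0$; for $k=1$ the product $(q)_{n_1-n_2}\cdots(q)_{n_{k-1}-n_k}$ is empty and equals $1$. *)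

theory Defs
  imports "HOL-Analysis.Analysis"
begin

definition qpoch :: "complex \<Rightarrow> complex \<Rightarrow> nat \<Rightarrow> complex" where
  "qpoch a p n = (\<Prod>j=1..n. 1 - a * p ^ (j - 1))"

definition qpoch_inf :: "complex \<Rightarrow> complex \<Rightarrow> complex" where
  "qpoch_inf a p = (\<Prod>j. 1 - a * p ^ j)"

text \<open>
  A tuple $n_1 \ge \cdots \ge n_k \ge 0$ is a function on \<open>{1..k}\<close>. It is required to be
  \<open>undefined\<close> outside of \<open>{1..k}\<close> so that each tuple occurs exactly once.
\<close>
definition decreasing_tuples :: "nat \<Rightarrow> (nat \<Rightarrow> nat) set" where
  "decreasing_tuples k =
     {n \<in> {1..k} \<rightarrow>\<^sub>E UNIV. \<forall>i\<in>{1..<k}. n (i + 1) \<le> n i}"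

end

theory Submission
  imports Defs
begin

text \<open>
  The sequence $\beta_n = (-q/z, -zq)_n / (q)_{2n+1}$ has, by a finite form of the Jacobi triple
  product, the expansion $\beta_n = \sum_{j \le n} A_j q^{j(j+1)/2} / ((q)_{n-j} (q)_{n+1+j})$ with
  Laurent polynomials $A_j$ in $z$. By the $q$-Vandermonde sum, the operator
  $(Bf)_n = \sum_{r \le n} q^{r(r+1)} f_r / (q)_{n-r}$ multiplies the $j$-th coefficient of such an
  expansion by $q^{j(j+1)}$. Evaluate $(B^k \beta)_N$ in two ways and let $N \to \infty$ by dominated
  convergence: written out, it tends to the multiple sum divided by $(q)_\infty$; expanded, it tends
  to $\sum_j A_j q^{(2k+1) j(j+1)/2} / (q)_\infty^2$. The case $k = 0$, with $q^{2k+1}$ in place of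
  $q$, evaluates the last series as an infinite product.
\<close>

section \<open>Finite identities\<close>

lemma qpoch_0 [simp]: "qpoch a p 0 = 1"
  by (simp add: qpoch_def)

lemma qpoch_Suc: "qpoch a p (Suc n) = qpoch a p n * (1 - a * p ^ n)"
  by (simp add: qpoch_def)

lemma qpoch_eq_lessThan: "qpoch a p n = (\<Prod>j<n. 1 - a * p ^ j)"
  by (induction n) (simp_all add: qpoch_Suc)

lemma one_minus_power_nonzero:
  fixes q :: complex
  assumes "norm q < 1"
  shows "1 - q ^ Suc n \<noteq> 0"
proof
  assume "1 - q ^ Suc n = 0"
  then have "norm (q ^ Suc n) = 1" by simp
  moreover have "norm (q ^ Suc n) < 1"
    using assms unfolding norm_power by (subst power_less_one_iff) auto
  ultimately show False by simp
qed

lemma qpoch_self_nonzero: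
  assumes "norm q < 1"
  shows "qpoch q q n \<noteq> 0"
  using one_minus_power_nonzero[OF assms] by (simp add: qpoch_eq_lessThan)

text \<open>
  Multiplying by $1 - q^{N+1} = q^s (1 - q^{N+1-s}) + (1 - q^s)$ turns the sum for $(N + 1, m)$
  into the sum for $(N, m + 1)$.
\<close>

lemma q_vandermonde:
  fixes q :: complex
  assumes q: "norm q < 1"
  shows "(\<Sum>s\<le>N. q ^ (s * (s + m)) / (qpoch q q (N - s) * qpoch q q s * qpoch q q (s + m)))
           = 1 / (qpoch q q N * qpoch q q (N + m))"
proof (induction N arbitrary: m)
  case 0
  then show ?case by simp
next
  case (Suc N)
  let ?P = "qpoch q q"
  let ?t = "\<lambda>s. q ^ (s * (s + m)) / (?P (Suc N - s) * ?P s * ?P (s + m))"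
  have split: "(1 - q ^ Suc N) * ?t s = q ^ s * (1 - q ^ (Suc N - s)) * ?t s + (1 - q ^ s) * ?t s"
    if "s \<le> Suc N" for s
  proof -
    have "q ^ Suc N = q ^ s * q ^ (Suc N - s)"
      using that by (metis le_add_diff_inverse power_add)
    then have "1 - q ^ Suc N = q ^ s * (1 - q ^ (Suc N - s)) + (1 - q ^ s)"
      by (simp add: algebra_simps)
    then show ?thesis by (simp only: ring_distribs(2))
  qed
  have first: "q ^ s * (1 - q ^ (Suc N - s)) * ?t s
      = q ^ (s * (s + Suc m)) * (1 - q ^ (s + Suc m)) / (?P (N - s) * ?P s * ?P (s + Suc m))" if "s \<le> N" for s
  proof -
    have "?P (Suc N - s) = ?P (N - s) * (1 - q ^ (Suc N - s))"
      using that by (simp add: Suc_diff_le qpoch_Suc)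
    moreover have "1 - q ^ (Suc N - s) \<noteq> 0"
      using that one_minus_power_nonzero[OF q, of "N - s"] by (simp add: Suc_diff_le)
    moreover have "?P (s + Suc m) = ?P (s + m) * (1 - q ^ (s + Suc m))"
      by (simp add: qpoch_Suc)
    moreover have "1 - q ^ (s + Suc m) \<noteq> 0"
      using one_minus_power_nonzero[OF q, of "s + m"] by simp
    moreover have "q ^ (s * (s + Suc m)) = q ^ s * q ^ (s * (s + m))"
      by (simp add: power_add)
    ultimately show ?thesis by (simp add: qpoch_self_nonzero[OF q])
  qed
  have second: "(1 - q ^ Suc s) * ?t (Suc s)
      = q ^ (s * (s + Suc m)) * q ^ (s + Suc m) / (?P (N - s) * ?P s * ?P (s + Suc m))" for s
  proof -
    have "?P (Suc s) = ?P s * (1 - q ^ Suc s)"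
      by (simp add: qpoch_Suc)
    moreover have "q ^ (Suc s * (Suc s + m)) = q ^ (s * (s + Suc m)) * q ^ (s + Suc m)"
      by (simp flip: power_add add: algebra_simps)
    moreover have idx: "Suc s + m = s + Suc m" "Suc N - Suc s = N - s"
      by simp_all
    ultimately show ?thesis
      using one_minus_power_nonzero[OF q, of s] unfolding idx
      by (simp del: power_Suc add_Suc add_Suc_right mult_Suc mult_Suc_right)
  qed
  have "(1 - q ^ Suc N) * (\<Sum>s\<le>Suc N. ?t s)
      = (\<Sum>s\<le>Suc N. q ^ s * (1 - q ^ (Suc N - s)) * ?t s) + (\<Sum>s\<le>Suc N. (1 - q ^ s) * ?t s)"
    unfolding sum_distrib_left sum.distrib[symmetric] by (intro sum.cong refl split) auto
  \<comment> \<open>Each sum loses one end: here the factor vanishes at \<open>s = 0\<close>, in the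
    other sum at \<open>s = Suc N\<close>.\<close>
  also have "(\<Sum>s\<le>Suc N. (1 - q ^ s) * ?t s) = (\<Sum>s\<le>N. (1 - q ^ Suc s) * ?t (Suc s))"
    by (subst sum.atMost_Suc_shift) simp
  also have "(\<Sum>s\<le>Suc N. q ^ s * (1 - q ^ (Suc N - s)) * ?t s) = (\<Sum>s\<le>N. q ^ s * (1 - q ^ (Suc N - s)) * ?t s)"
    by simp
  \<comment> \<open>By \<open>first\<close> and \<open>second\<close>, the two contributions of one
    \<open>s\<close> are $1 - q^{s+m+1}$ and $q^{s+m+1}$ times the same term of the sum for $(N, m +
    1)$.\<close>
  also have "(\<Sum>s\<le>N. q ^ s * (1 - q ^ (Suc N - s)) * ?t s) + (\<Sum>s\<le>N. (1 - q ^ Suc s) * ?t (Suc s))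
      = (\<Sum>s\<le>N. q ^ (s * (s + Suc m)) / (?P (N - s) * ?P s * ?P (s + Suc m)))"
    unfolding sum.distrib[symmetric]
  proof (intro sum.cong refl)
    fix s assume "s \<in> {..N}"
    then have "s \<le> N" by simp
    show "q ^ s * (1 - q ^ (Suc N - s)) * ?t s + (1 - q ^ Suc s) * ?t (Suc s)
      = q ^ (s * (s + Suc m)) / (?P (N - s) * ?P s * ?P (s + Suc m))"
      unfolding first[OF \<open>s \<le> N\<close>] second by (simp only: add_divide_distrib[symmetric] ring_distribs) simp
  qed
  also have "\<dots> = 1 / (?P N * ?P (N + Suc m))"
    by (rule Suc.IH)
  finally have "(1 - q ^ Suc N) * (\<Sum>s\<le>Suc N. ?t s) = 1 / (?P N * ?P (Suc N + m))"
    by simp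
  moreover have "?P (Suc N) = ?P N * (1 - q ^ Suc N)"
    by (simp add: qpoch_Suc)
  moreover have cancel: "x = 1 / (a * c * b)" if "c * x = 1 / (a * b)" "c \<noteq> 0" for a b c x :: complex
    using that by (metis divide_divide_eq_left mult.assoc mult.commute nonzero_mult_div_cancel_left)
  ultimately show ?case
    using one_minus_power_nonzero[OF q, of N] by (simp only: cancel)
qed

section \<open>Kernel expansion and the finite triple product\<close>

text \<open>
  \<open>jacobi_coeff z j\<close> is the Laurent polynomial $(z^j + z^{-j-1}) / (1 + z^{-1})$. It pairs the terms
  $j$ and $-j - 1$ of the theta series, after division by the factor $1 + 1/z$, which may vanish.
\<close>

fun jacobi_coeff :: "complex \<Rightarrow> nat \<Rightarrow> complex" where
  "jacobi_coeff z 0 = 1"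
| "jacobi_coeff z (Suc 0) = z + 1 / z - 1"
| "jacobi_coeff z (Suc (Suc j)) = (z + 1 / z) * jacobi_coeff z (Suc j) - jacobi_coeff z j"

text \<open>
  For \<open>j = 0\<close> the truncated subtraction gives the right value, because the Laurent polynomials are
  invariant under $j \mapsto -1 - j$. The same holds for \<open>bailey_kernel_rec\<close> below.
\<close>

lemma jacobi_coeff_rec:
  "(z + 1 / z) * jacobi_coeff z j = jacobi_coeff z (Suc j) + jacobi_coeff z (j - 1)"
  by (cases j) simp_all

lemma double_triangle: "2 * triangle j = j * (j + 1)"
  by (induction j) simp_all

text \<open>Up to the constant factor $1 - q$ these are the weights $1 / ((q)_{n-j} (aq)_{n+j})$ of
  a Bailey pair relative to $a = q$. The explicit zero for \<open>j > n\<close>, where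
  \<open>n - j\<close> is truncated, lets sums over \<open>j\<close> be extended freely.\<close>

definition bailey_kernel :: "complex \<Rightarrow> nat \<Rightarrow> nat \<Rightarrow> complex" where
  "bailey_kernel q n j =
     (if j \<le> n then 1 / (qpoch q q (n - j) * qpoch q q (n + 1 + j)) else 0)"

text \<open>This is the induction step of \<open>finite_jacobi\<close> read off coefficientwise: the
  shifts of \<open>j\<close> stand for multiplication by $z + 1/z$. All terms are polynomials in
  $q$, $q^j$ and $q^{n+1-j}$ times one common factor, so that a polynomial identity remains.\<close>

lemma bailey_kernel_rec:
  fixes q :: complex
  assumes q: "norm q < 1"
  defines "c \<equiv> \<lambda>n j. q ^ triangle j * bailey_kernel q n j"
  shows "(1 - q ^ (2 * n + 2)) * (1 - q ^ (2 * n + 3)) * c (Suc n) j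
          = (1 + q ^ (2 * n + 2)) * c n j + q ^ (n + 1) * (c n (Suc j) + c n (j - 1))"
proof (cases "j \<le> n + 1")
  case False
  then show ?thesis by (simp add: c_def bailey_kernel_def)
next
  case True
  then obtain e where e: "n + 1 = j + e"
    using le_Suc_ex by blast
  let ?P = "qpoch q q"
  define x u t X Y where "x = q ^ j" and "u = q ^ e" and "t = q ^ triangle j"
    and "X = ?P e" and "Y = ?P (2 * j + e + 1)"
  note nz = qpoch_self_nonzero[OF q]
  have XY: "X \<noteq> 0" "Y \<noteq> 0"
    by (simp_all add: X_def Y_def nz)
  have pow: "q ^ (n + 1) = x * u"
    by (simp only: e x_def u_def power_add)
  have pow2: "q ^ (2 * n + 2) = x\<^sup>2 * u\<^sup>2" "q ^ (2 * n + 3) = q * (x\<^sup>2 * u\<^sup>2)"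
  proof -
    have "2 * n + 2 = (n + 1) * 2" by simp
    then have "q ^ (2 * n + 2) = (q ^ (n + 1))\<^sup>2"
      by (simp only: power_mult)
    then show "q ^ (2 * n + 2) = x\<^sup>2 * u\<^sup>2"
      by (simp only: pow power_mult_distrib)
    moreover have "q ^ (2 * n + 3) = q * q ^ (2 * n + 2)"
      by (simp add: numeral_eq_Suc)
    ultimately show "q ^ (2 * n + 3) = q * (x\<^sup>2 * u\<^sup>2)" by simp
  qed
  have Y: "Y = ?P (2 * j + e) * (1 - q * (x\<^sup>2 * u))" "?P (2 * j + e) \<noteq> 0" "1 - q * (x\<^sup>2 * u) \<noteq> 0"
    using XY by (simp_all add: nz Y_def qpoch_Suc x_def u_def power_add mult_2 power2_eq_square)
  have c1: "c (Suc n) j = t / (X * Y)"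
  proof -
    have *: "Suc n - j = e" "Suc n + 1 + j = 2 * j + e + 1" using e by auto
    show ?thesis unfolding c_def bailey_kernel_def * using True by (simp add: t_def X_def Y_def)
  qed
  have c2: "c n j = t * ((1 - u) * (1 - q * (x\<^sup>2 * u))) / (X * Y)"
  proof (cases e)
    case 0
    then show ?thesis using e by (simp add: c_def bailey_kernel_def u_def)
  next
    case (Suc d)
    then have *: "j \<le> n" "n - j = d" "n + 1 + j = 2 * j + e" using e by auto
    have "X = ?P d * (1 - u)"
      by (simp add: X_def Suc qpoch_Suc u_def)
    with XY show ?thesis
      unfolding Y c_def bailey_kernel_def * t_def[symmetric] using * Y by simp
  qed
  have c3: "q ^ (n + 1) * c n (Suc j) = t * (x\<^sup>2 * u * (q - u) * (1 - u)) / (X * Y)"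
  proof (cases "j < n")
    case False
    \<comment> \<open>The kernel is zero in both cases, matched by $1 - u = 0$ for
      \<open>e = 0\<close> and $q - u = 0$ for \<open>e = 1\<close>.\<close>
    then consider "e = 0" | "e = 1" using e by linarith
    then show ?thesis using False by cases (simp_all add: c_def bailey_kernel_def u_def)
  next
    case True
    then obtain d where d: "e = Suc (Suc d)"
      using e by (metis add_Suc_right add.right_neutral less_irrefl not_less_eq old.nat.exhaust
          Suc_eq_plus1 le_add1 linorder_not_less)
    have *: "Suc j \<le> n" "n - Suc j = d" "n + 1 + Suc j = 2 * j + e + 1" using e d by auto
    \<comment> \<open>The factor \<open>q\<close> gained from \<open>triangle (Suc j)\<close> stays
      in the numerator, because \<open>q\<close> may be zero.\<close>
    have "q * X = ?P d * ((q - u) * (1 - u))"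
      by (simp add: X_def d qpoch_Suc u_def algebra_simps)
    then have "q / ?P d = (q - u) * (1 - u) / X"
      using XY nz[of d] by (simp add: field_simps)
    moreover have "q ^ (n + 1) * c n (Suc j) = t * (x\<^sup>2 * u) / Y * (q / ?P d)"
      unfolding pow c_def bailey_kernel_def * Y_def
      using * by (simp add: t_def x_def power_add power2_eq_square mult_ac)
    ultimately show ?thesis by (simp add: mult_ac)
  qed
  have c4: "q ^ (n + 1) * c n (j - 1) = t * (u * (1 - x\<^sup>2 * u) * (1 - q * (x\<^sup>2 * u))) / (X * Y)"
  proof -
    have "Y = ?P (n + j) * (1 - x\<^sup>2 * u) * (1 - q * (x\<^sup>2 * u))" "?P (n + j) \<noteq> 0" "1 - x\<^sup>2 * u \<noteq> 0"
    proof -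
      have *: "2 * j + e = Suc (n + j)" using e by simp
      have "q ^ Suc (n + j) = x\<^sup>2 * u"
        unfolding *[symmetric] by (simp add: x_def u_def power_add mult_2 power2_eq_square)
      then show "Y = ?P (n + j) * (1 - x\<^sup>2 * u) * (1 - q * (x\<^sup>2 * u))" "1 - x\<^sup>2 * u \<noteq> 0"
        using Y unfolding * by (simp_all add: qpoch_Suc)
    qed (rule nz)
    moreover have "x * c n (j - 1) = t / (X * ?P (n + j))"
    proof (cases j)
      \<comment> \<open>The index $-1$ is truncated to 0. Both have triangular number 0, and the two
        Pochhammer factors of the kernel merely trade places.\<close>
      case 0
      then show ?thesis using e by (simp add: c_def bailey_kernel_def x_def t_def X_def mult.commute flip: e)
    next
      case (Suc i)
      then have "i \<le> n" "n - i = e" "n + 1 + i = n + j" using e by auto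
      then show ?thesis using Suc
        by (simp add: c_def bailey_kernel_def x_def t_def X_def power_add)
    qed
    ultimately show ?thesis
      unfolding pow using XY by (simp add: divide_simps mult_ac)
  qed
  \<comment> \<open>This is the recurrence divided by the common factor
    \<open>t / (X * Y)\<close>.\<close>
  have "(1 - x\<^sup>2 * u\<^sup>2) * (1 - q * (x\<^sup>2 * u\<^sup>2))
      = (1 + x\<^sup>2 * u\<^sup>2) * ((1 - u) * (1 - q * (x\<^sup>2 * u))) + x\<^sup>2 * u * (q - u) * (1 - u)
        + u * (1 - x\<^sup>2 * u) * (1 - q * (x\<^sup>2 * u))"
    by algebra
  then show ?thesis
    unfolding ring_distribs(1)[of "q ^ (n + 1)"] c1 c2 c3 c4 pow2
    by (simp add: add_divide_distrib[symmetric] ring_distribs(1)[symmetric] mult.left_commute[of _ t] add.assoc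
       del: right_diff_distrib)
qed

text \<open>From \<open>n\<close> to \<open>n + 1\<close> the numerator gains $(1 + q^{n+1}/z)(1 +
  zq^{n+1}) = 1 + q^{2n+2} + q^{n+1}(z + 1/z)$. Multiplication by $z + 1/z$ shifts the Laurent
  polynomials; summation by parts moves the shift to the kernel, where
  \<open>bailey_kernel_rec\<close> applies.\<close>

lemma finite_jacobi:
  fixes q z :: complex
  assumes q: "norm q < 1" and z: "z \<noteq> 0"
  shows "qpoch (- q / z) q n * qpoch (- z * q) q n / qpoch q q (2 * n + 1)
           = (\<Sum>j\<le>n. jacobi_coeff z j * q ^ triangle j * bailey_kernel q n j)"
proof (induction n)
  case 0
  then show ?case by (simp add: bailey_kernel_def)
next
  case (Suc n)
  let ?P = "qpoch q q"
  let ?c = "\<lambda>n j. q ^ triangle j * bailey_kernel q n j"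
  let ?A = "jacobi_coeff z"
  let ?S = "\<lambda>n. \<Sum>j\<le>n. ?A j * q ^ triangle j * bailey_kernel q n j"
  note nz = qpoch_self_nonzero[OF q] one_minus_power_nonzero[OF q, unfolded power_Suc]
  have c0: "bailey_kernel q n (Suc n) = 0" "bailey_kernel q n (Suc (Suc n)) = 0"
    by (simp_all add: bailey_kernel_def)
  have "(z + 1 / z) * ?S n = (\<Sum>j\<le>n. (?A (Suc j) + ?A (j - 1)) * ?c n j)"
    unfolding sum_distrib_left jacobi_coeff_rec[symmetric] by (simp add: mult.assoc)
  also have "\<dots> = (\<Sum>j\<le>n. ?A (Suc j) * ?c n j) + (\<Sum>j\<le>n. ?A (j - 1) * ?c n j)"
    by (simp add: ring_distribs sum.distrib)
  also have "(\<Sum>j\<le>n. ?A (j - 1) * ?c n j) = (\<Sum>j\<le>Suc (Suc n). ?A (j - 1) * ?c n j)"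
    by (simp add: c0)
  also have "\<dots> = ?c n 0 + (\<Sum>j\<le>Suc n. ?A j * ?c n (Suc j))"
    by (subst sum.atMost_Suc_shift) simp
  \<comment> \<open>The boundary term left by the first shift is exactly the term
    \<open>j = 0\<close> of the other sum, where \<open>j - 1\<close> is truncated to 0.\<close>
  also have "(\<Sum>j\<le>n. ?A (Suc j) * ?c n j) + (?c n 0 + (\<Sum>j\<le>Suc n. ?A j * ?c n (Suc j)))
     = (\<Sum>j\<le>Suc n. ?A j * ?c n (j - 1)) + (\<Sum>j\<le>Suc n. ?A j * ?c n (Suc j))"
    by (subst (2) sum.atMost_Suc_shift) simp
  finally have shift: "(z + 1 / z) * ?S n = (\<Sum>j\<le>Suc n. ?A j * (?c n (Suc j) + ?c n (j - 1)))"
    by (simp only: sum.distrib[symmetric] ring_distribs add.commute)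
  have "(1 - q ^ (2 * n + 2)) * (1 - q ^ (2 * n + 3)) * ?S (Suc n)
      = (\<Sum>j\<le>Suc n. ?A j * ((1 - q ^ (2 * n + 2)) * (1 - q ^ (2 * n + 3)) * ?c (Suc n) j))"
    unfolding sum_distrib_left by (intro sum.cong refl) (simp only: mult_ac)
  also have "\<dots> = (\<Sum>j\<le>Suc n. ?A j * ((1 + q ^ (2 * n + 2)) * ?c n j + q ^ (n + 1) * (?c n (Suc j) + ?c n (j - 1))))"
    by (simp only: bailey_kernel_rec[OF q])
  also have "\<dots> = (1 + q ^ (2 * n + 2)) * (\<Sum>j\<le>Suc n. ?A j * q ^ triangle j * bailey_kernel q n j)
      + q ^ (n + 1) * (\<Sum>j\<le>Suc n. ?A j * (?c n (Suc j) + ?c n (j - 1)))"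
    unfolding sum_distrib_left sum.distrib[symmetric]
    by (intro sum.cong refl) (simp only: ring_distribs mult_ac)
  also have "(\<Sum>j\<le>Suc n. ?A j * q ^ triangle j * bailey_kernel q n j) = ?S n"
    by (simp add: c0)
  also have "(1 + q ^ (2 * n + 2)) * ?S n
      + q ^ (n + 1) * (\<Sum>j\<le>Suc n. ?A j * (?c n (Suc j) + ?c n (j - 1)))
     = (1 + q ^ (2 * n + 2) + q ^ (n + 1) * (z + 1 / z)) * ?S n"
    unfolding shift[symmetric] by (simp only: ring_distribs mult_ac)
  also have "1 + q ^ (2 * n + 2) + q ^ (n + 1) * (z + 1 / z)
     = (1 + q / z * q ^ n) * (1 + z * q * q ^ n)"
    using z by (simp add: field_simps power_add mult_2 mult_2_right power2_eq_square)
  finally have "(1 - q ^ (2 * n + 2)) * (1 - q ^ (2 * n + 3)) * ?S (Suc n)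
     = (1 + q / z * q ^ n) * (1 + z * q * q ^ n) *
        (qpoch (- q / z) q n * qpoch (- z * q) q n / qpoch q q (2 * n + 1))"
    by (simp only: Suc.IH)
  moreover have "?P (2 * Suc n + 1) = ?P (2 * n + 1) * (1 - q ^ (2 * n + 2)) * (1 - q ^ (2 * n + 3))"
    by (simp add: qpoch_Suc numeral_eq_Suc)
  moreover have "1 - q ^ (2 * n + 2) \<noteq> 0" "1 - q ^ (2 * n + 3) \<noteq> 0"
    using one_minus_power_nonzero[OF q, of "2 * n + 1"] one_minus_power_nonzero[OF q, of "2 * n + 2"]
    by (simp_all add: numeral_eq_Suc)
  ultimately show ?case
    using nz by (simp add: qpoch_Suc divide_simps mult_ac)
qed

section \<open>Iterating the Bailey step\<close>

definition bailey_step :: "complex \<Rightarrow> (nat \<Rightarrow> complex) \<Rightarrow> nat \<Rightarrow> complex" where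
  "bailey_step q f n = (\<Sum>r\<le>n. q ^ (r * (r + 1)) / qpoch q q (n - r) * f r)"

text \<open>
  This is the limit $\rho_1, \rho_2 \to \infty$ of Bailey's lemma relative to $a = q$.
\<close>

lemma bailey_step_kernel:
  fixes q :: complex
  assumes q: "norm q < 1"
  shows "bailey_step q (\<lambda>r. bailey_kernel q r j) n = q ^ (j * (j + 1)) * bailey_kernel q n j"
proof (cases "j \<le> n")
  case False
  then show ?thesis by (simp add: bailey_step_def bailey_kernel_def)
next
  case True
  let ?P = "qpoch q q"
  let ?t = "\<lambda>r. q ^ (r * (r + 1)) / ?P (n - r) * bailey_kernel q r j"
  have "bailey_step q (\<lambda>r. bailey_kernel q r j) n = (\<Sum>r\<in>{j..n}. ?t r)"
    unfolding bailey_step_def by (rule sum.mono_neutral_right) (auto simp: bailey_kernel_def)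
  also have "\<dots> = (\<Sum>s\<le>n - j. ?t (s + j))"
    using True by (intro sum.reindex_bij_witness[of _ "\<lambda>s. s + j" "\<lambda>r. r - j"]) auto
  also have "\<dots> = (\<Sum>s\<le>n - j. q ^ (j * (j + 1)) *
      (q ^ (s * (s + (2 * j + 1))) / (?P (n - j - s) * ?P s * ?P (s + (2 * j + 1)))))"
  proof (intro sum.cong refl)
    fix s
    \<comment> \<open>With $r = s + j$ the exponent releases $j(j+1)$, leaving the q-Vandermonde sum
      with $m = 2j + 1$.\<close>
    have "(s + j) * (s + j + 1) = j * (j + 1) + s * (s + (2 * j + 1))"
      by (simp add: algebra_simps)
    then have "q ^ ((s + j) * (s + j + 1)) = q ^ (j * (j + 1)) * q ^ (s * (s + (2 * j + 1)))"
      by (simp only: power_add)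
    moreover have idx: "s + j + 1 + j = s + (2 * j + 1)" "n - (s + j) = n - j - s"
      by simp_all
    ultimately show "?t (s + j) = q ^ (j * (j + 1)) *
      (q ^ (s * (s + (2 * j + 1))) / (?P (n - j - s) * ?P s * ?P (s + (2 * j + 1))))"
      unfolding bailey_kernel_def idx by simp
  qed
  also have "\<dots> = q ^ (j * (j + 1)) * (1 / (?P (n - j) * ?P (n - j + (2 * j + 1))))"
    unfolding sum_distrib_left[symmetric] q_vandermonde[OF q] ..
  also have "n - j + (2 * j + 1) = n + 1 + j"
    using True by simp
  finally show ?thesis
    using True by (simp add: bailey_kernel_def)
qed

text \<open>By linearity each step acts on the kernels separately, and each kernel is an eigenvector
  with eigenvalue $q^{j(j+1)}$.\<close>

lemma bailey_lemma:
  fixes q :: complex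
  assumes q: "norm q < 1"
  shows "(bailey_step q ^^ k) (\<lambda>n. \<Sum>j\<le>n. a j * bailey_kernel q n j) n
    = (\<Sum>j\<le>n. a j * q ^ (k * (j * (j + 1))) * bailey_kernel q n j)"
proof (induction k arbitrary: n)
  case 0
  then show ?case by simp
next
  case (Suc k)
  let ?a = "\<lambda>j. a j * q ^ (k * (j * (j + 1)))"
  \<comment> \<open>A range of \<open>j\<close> independent of \<open>r\<close> allows the two sums
    to be swapped.\<close>
  have extend: "(\<Sum>j\<le>r. ?a j * bailey_kernel q r j) = (\<Sum>j\<le>n. ?a j * bailey_kernel q r j)"
    if "r \<le> n" for r
    using that by (intro sum.mono_neutral_left) (auto simp: bailey_kernel_def)
  have "(bailey_step q ^^ Suc k) (\<lambda>n. \<Sum>j\<le>n. a j * bailey_kernel q n j) n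
      = (\<Sum>r\<le>n. q ^ (r * (r + 1)) / qpoch q q (n - r) * (\<Sum>j\<le>r. ?a j * bailey_kernel q r j))"
    by (simp add: bailey_step_def Suc.IH)
  also have "\<dots> = (\<Sum>r\<le>n. \<Sum>j\<le>n. ?a j * (q ^ (r * (r + 1)) / qpoch q q (n - r) * bailey_kernel q r j))"
    by (intro sum.cong refl, simp only: atMost_iff extend sum_distrib_left)
       (simp only: mult_ac)
  also have "\<dots> = (\<Sum>j\<le>n. ?a j * bailey_step q (\<lambda>r. bailey_kernel q r j) n)"
    unfolding bailey_step_def sum_distrib_left by (rule sum.swap)
  also have "\<dots> = (\<Sum>j\<le>n. a j * q ^ (Suc k * (j * (j + 1))) * bailey_kernel q n j)"
    unfolding bailey_step_kernel[OF q]
    by (simp add: power_add mult_ac del: power_Suc)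
  finally show ?case .
qed

section \<open>Iterated steps as sums over decreasing tuples\<close>

text \<open>The part of the summand produced by the nested steps, without the outermost denominator
  $(q)_{N-n_1}$ and without the factor that depends on \<open>n k\<close> through the initial
  sequence.\<close>

definition tuple_weight :: "complex \<Rightarrow> nat \<Rightarrow> (nat \<Rightarrow> nat) \<Rightarrow> complex" where
  "tuple_weight q k n =
     q ^ (\<Sum>i=1..k. n i * (n i + 1)) / (\<Prod>i=1..<k. qpoch q q (n i - n (i + 1)))"

lemma decreasing_tuples_antimono:
  assumes "n \<in> decreasing_tuples k" "1 \<le> i" "i \<le> j" "j \<le> k"
  shows "n j \<le> n i"
  using assms(3,4)
proof (induction j rule: dec_induct)
  case (step m)
  have "n (m + 1) \<le> n m"
    using assms(1,2) step.hyps step.prems by (auto simp: decreasing_tuples_def)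
  also have "\<dots> \<le> n i"
    using step by simp
  finally show ?case by simp
qed simp

lemma finite_bounded_tuples: "finite {n \<in> decreasing_tuples k. n 1 \<le> N}"
proof (rule finite_subset)
  show "{n \<in> decreasing_tuples k. n 1 \<le> N} \<subseteq> {1..k} \<rightarrow>\<^sub>E {..N}"
  proof
    fix n assume n: "n \<in> {n \<in> decreasing_tuples k. n 1 \<le> N}"
    then have "n i \<le> N" if "i \<in> {1..k}" for i
      using decreasing_tuples_antimono[of n k 1 i] that by auto
    with n show "n \<in> {1..k} \<rightarrow>\<^sub>E {..N}"
      by (auto simp: decreasing_tuples_def PiE_iff)
  qed
qed (simp add: finite_PiE)

text \<open>Longer tuples arise by appending a last entry \<open>r \<le> n k\<close>; as
  \<open>k \<ge> 1\<close>, the bounded entry \<open>n 1\<close> is unaffected.\<close>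

lemma sum_bounded_tuples_Suc:
  assumes "k \<ge> 1"
  shows "(\<Sum>n | n \<in> decreasing_tuples (Suc k) \<and> n 1 \<le> N. F n)
           = (\<Sum>n | n \<in> decreasing_tuples k \<and> n 1 \<le> N. \<Sum>r\<le>n k. F (n(Suc k := r)))"
proof -
  have "(\<Sum>n | n \<in> decreasing_tuples k \<and> n 1 \<le> N. \<Sum>r\<le>n k. F (n(Suc k := r)))
      = (\<Sum>(n, r)\<in>Sigma {n \<in> decreasing_tuples k. n 1 \<le> N} (\<lambda>n. {..n k}). F (n(Suc k := r)))"
    by (rule sum.Sigma) (simp_all add: finite_bounded_tuples del: One_nat_def)
  also have "\<dots> = (\<Sum>n | n \<in> decreasing_tuples (Suc k) \<and> n 1 \<le> N. F n)"
  \<comment> \<open>Deleting the last entry resets it to \<open>undefined\<close>, as membership in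
    \<open>decreasing_tuples k\<close> demands.\<close>
  proof (rule sum.reindex_bij_witness[of _ "\<lambda>n. (n(Suc k := undefined), n (Suc k))" "\<lambda>(n, r). n(Suc k := r)"])
    fix a assume a: "a \<in> Sigma {n \<in> decreasing_tuples k. n 1 \<le> N} (\<lambda>n. {..n k})"
    obtain n r where nr: "a = (n, r)" by (cases a)
    have "n (Suc k) = undefined"
      using a by (auto simp: nr decreasing_tuples_def PiE_iff extensional_def)
    then show "(\<lambda>n. (n(Suc k := undefined), n (Suc k))) ((\<lambda>(n, r). n(Suc k := r)) a) = a"
      by (auto simp: nr)
    have "i = k" if "i < Suc k" "\<not> i < k" for i using that by simp
    with a assms show "(\<lambda>(n, r). n(Suc k := r)) a \<in> {n \<in> decreasing_tuples (Suc k). n 1 \<le> N}"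
      by (auto simp: nr decreasing_tuples_def PiE_iff extensional_def)
  next
    fix n assume n: "n \<in> {n \<in> decreasing_tuples (Suc k). n 1 \<le> N}"
    show "(\<lambda>(n, r). n(Suc k := r)) (n(Suc k := undefined), n (Suc k)) = n" by simp
    show "(n(Suc k := undefined), n (Suc k)) \<in> Sigma {n \<in> decreasing_tuples k. n 1 \<le> N} (\<lambda>n. {..n k})"
      using n assms by (auto simp: decreasing_tuples_def PiE_iff extensional_def)
  qed auto
  finally show ?thesis ..
qed

lemma tuple_weight_Suc:
  assumes "k \<ge> 1"
  shows "tuple_weight q (Suc k) (n(Suc k := r))
           = tuple_weight q k n * (q ^ (r * (r + 1)) / qpoch q q (n k - r))"
proof -
  have "(\<Sum>i=1..k. (n(Suc k := r)) i * ((n(Suc k := r)) i + 1)) = (\<Sum>i=1..k. n i * (n i + 1))"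
    by (rule sum.cong) auto
  moreover have "(\<Prod>i=1..<k. qpoch q q ((n(Suc k := r)) i - (n(Suc k := r)) (i + 1)))
      = (\<Prod>i=1..<k. qpoch q q (n i - n (i + 1)))"
    by (rule prod.cong) auto
  ultimately show ?thesis
    using assms by (simp add: tuple_weight_def power_add prod.atLeastLessThan_Suc)
qed

text \<open>The outermost step chooses $n_1 \<le> N$, the next one $n_2 \<le> n_1$, and so on down
  to the argument $n_k$ of \<open>f\<close>.\<close>

lemma bailey_step_funpow:
  assumes "k \<ge> 1"
  shows "(bailey_step q ^^ k) f N
    = (\<Sum>n | n \<in> decreasing_tuples k \<and> n 1 \<le> N. tuple_weight q k n / qpoch q q (N - n 1) * f (n k))"
  using assms
proof (induction k arbitrary: f rule: dec_induct)
  case base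
  have "(\<Sum>n | n \<in> decreasing_tuples 1 \<and> n 1 \<le> N. tuple_weight q 1 n / qpoch q q (N - n 1) * f (n 1))
      = (\<Sum>r\<le>N. q ^ (r * (r + 1)) / qpoch q q (N - r) * f r)"
    by (rule sum.reindex_bij_witness[of _ "\<lambda>r i. if i = 1 then r else undefined" "\<lambda>n. n 1"])
       (auto simp: decreasing_tuples_def PiE_iff extensional_def tuple_weight_def)
  then show ?case by (simp add: bailey_step_def)
next
  case (step k)
  \<comment> \<open>Splitting off the innermost step makes the new index the last entry; the
    induction hypothesis is used for \<open>bailey_step q f\<close>.\<close>
  have "(bailey_step q ^^ Suc k) f N = (bailey_step q ^^ k) (bailey_step q f) N"
    by (simp only: funpow_Suc_right o_apply)
  also have "\<dots> = (\<Sum>n | n \<in> decreasing_tuples k \<and> n 1 \<le> N. \<Sum>r\<le>n k.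
       tuple_weight q k n / qpoch q q (N - n 1) * (q ^ (r * (r + 1)) / qpoch q q (n k - r) * f r))"
    unfolding step.IH bailey_step_def sum_distrib_left ..
  also have "\<dots> = (\<Sum>n | n \<in> decreasing_tuples k \<and> n 1 \<le> N. \<Sum>r\<le>n k.
       tuple_weight q (Suc k) (n(Suc k := r)) / qpoch q q (N - (n(Suc k := r)) 1) * f ((n(Suc k := r)) (Suc k)))"
    unfolding tuple_weight_Suc[OF step.hyps(1)] using step.hyps(1)
    by (intro sum.cong refl) (simp add: mult_ac)
  finally show ?case
    unfolding sum_bounded_tuples_Suc[OF step.hyps(1)] .
qed

section \<open>Passing to the limit\<close>

lemma convergent_prod_qpoch:
  fixes a p :: complex
  assumes "norm p < 1"
  shows "convergent_prod (\<lambda>j. 1 - a * p ^ j)"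
proof (intro abs_convergent_prod_imp_convergent_prod summable_imp_abs_convergent_prod)
  have "summable (\<lambda>j. norm a * norm p ^ j)"
    using assms by (intro summable_mult summable_geometric) simp
  then show "summable (\<lambda>j. norm (1 - a * p ^ j - 1))"
    by (simp add: norm_mult norm_power)
qed

lemma qpoch_tendsto:
  assumes "norm p < 1"
  shows "qpoch a p \<longlonglongrightarrow> qpoch_inf a p"
proof -
  have "(\<lambda>n. \<Prod>j\<le>n. 1 - a * p ^ j) \<longlonglongrightarrow> qpoch_inf a p"
    unfolding qpoch_inf_def by (intro convergent_prod_LIMSEQ convergent_prod_qpoch assms)
  then have "(\<lambda>n. qpoch a p (Suc n)) \<longlonglongrightarrow> qpoch_inf a p"
    by (simp add: qpoch_eq_lessThan lessThan_Suc_atMost)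
  then show ?thesis
    by (simp only: filterlim_sequentially_Suc)
qed

lemma qpoch_inf_self_nonzero:
  assumes "norm q < 1"
  shows "qpoch_inf q q \<noteq> 0"
  unfolding qpoch_inf_def
  using convergent_prod_qpoch[OF assms] one_minus_power_nonzero[OF assms]
  by (intro prodinf_nonzero) simp_all

text \<open>The reciprocals converge because $(q)_n$ has a nonzero limit. The uniform bound supplies
  the majorants for both limit interchanges.\<close>

lemma inverse_qpoch_self_bounded:
  assumes "norm q < 1"
  obtains C where "C \<ge> 0" "\<And>n. norm (1 / qpoch q q n) \<le> C"
proof -
  have "(\<lambda>n. 1 / qpoch q q n) \<longlonglongrightarrow> 1 / qpoch_inf q q"
    by (intro tendsto_intros qpoch_tendsto qpoch_inf_self_nonzero assms)
  then have "Bseq (\<lambda>n. 1 / qpoch q q n)"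
    by (rule convergentI[THEN convergent_imp_Bseq])
  then show ?thesis
    using that by (elim BseqE) (auto intro: less_imp_le)
qed

text \<open>For fixed \<open>j\<close> the kernel tends to $1/(q)_\<infinity>^2$ and is bounded by
  $C^2$ uniformly in \<open>n\<close> and \<open>j\<close>, so Tannery's theorem applies.\<close>

lemma bailey_kernel_sum_tendsto:
  fixes q :: complex
  assumes q: "norm q < 1" and a: "summable (\<lambda>j. norm (a j))"
  shows "(\<lambda>n. \<Sum>j\<le>n. a j * bailey_kernel q n j) \<longlonglongrightarrow> suminf a / (qpoch_inf q q)\<^sup>2"
proof -
  let ?P = "qpoch q q" and ?L = "qpoch_inf q q"
  obtain C where C: "C \<ge> 0" "\<And>n. norm (1 / ?P n) \<le> C"
    using inverse_qpoch_self_bounded[OF q] by metis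
  have lim: "(\<lambda>n. a j * bailey_kernel q n j) \<longlonglongrightarrow> a j * (1 / (?L * ?L))" for j
  proof -
    have "(\<lambda>n. ?P (n - j)) \<longlonglongrightarrow> ?L"
      by (rule filterlim_compose[OF qpoch_tendsto[OF q] filterlim_minus_const_nat_at_top])
    moreover have "(\<lambda>n. ?P (n + (1 + j))) \<longlonglongrightarrow> ?L"
      by (rule LIMSEQ_ignore_initial_segment[OF qpoch_tendsto[OF q]])
    ultimately have "(\<lambda>n. a j * (1 / (?P (n - j) * ?P (n + (1 + j))))) \<longlonglongrightarrow> a j * (1 / (?L * ?L))"
      by (intro tendsto_intros) (simp_all add: qpoch_inf_self_nonzero[OF q])
    then show ?thesis
      by (rule Lim_transform_eventually)
         (use eventually_ge_at_top[of j] in eventually_elim, simp add: bailey_kernel_def add.assoc)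
  qed
  have "norm (bailey_kernel q n j) \<le> C * C" for n j
  proof (cases "j \<le> n")
    case True
    then have "norm (bailey_kernel q n j) = norm (1 / ?P (n - j)) * norm (1 / ?P (n + 1 + j))"
      by (simp add: bailey_kernel_def norm_mult norm_divide)
    also have "\<dots> \<le> C * C"
      by (intro mult_mono C) auto
    finally show ?thesis .
  qed (simp add: bailey_kernel_def)
  then have "norm (a j * bailey_kernel q n j) \<le> norm (a j) * (C * C)" for n j
    unfolding norm_mult by (intro mult_left_mono) auto
  then have "(\<lambda>n. \<Sum>j. a j * bailey_kernel q n j) \<longlonglongrightarrow> (\<Sum>j. a j * (1 / (?L * ?L)))"
    using tannerys_theorem[where a = "\<lambda>j n. a j * bailey_kernel q n j" and F = sequentially
        and M = "\<lambda>j. norm (a j) * (C * C)", OF lim] summable_mult2[OF a]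
    by (simp add: case_prod_unfold)
  moreover have "(\<Sum>j. a j * bailey_kernel q n j) = (\<Sum>j\<le>n. a j * bailey_kernel q n j)" for n
    by (rule suminf_finite) (auto simp: bailey_kernel_def)
  moreover have "(\<Sum>j. a j * (1 / (?L * ?L))) = suminf a * (1 / (?L * ?L))"
    by (rule suminf_mult2[symmetric, OF summable_norm_cancel[OF a]])
  ultimately show ?thesis
    by (simp add: power2_eq_square)
qed

section \<open>The theta series and the Jacobi triple product\<close>

text \<open>Geometric growth is harmless against $q^{j(j+1)/2}$. The added 1 in the base absorbs the
  second term of the recursion.\<close>

lemma norm_jacobi_coeff_le: "norm (jacobi_coeff z j) \<le> (norm (z + 1 / z) + 1) ^ j"
proof (induction z j rule: jacobi_coeff.induct)
  case (1 z)
  then show ?case by simp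
next
  case (2 z)
  then show ?case using norm_triangle_ineq4[of "z + 1 / z" 1] by simp
next
  case (3 z j)
  let ?w = "norm (z + 1 / z)"
  have "norm (jacobi_coeff z (Suc (Suc j))) \<le> ?w * norm (jacobi_coeff z (Suc j)) + norm (jacobi_coeff z j)"
    unfolding jacobi_coeff.simps norm_mult[symmetric] by (rule norm_triangle_ineq4)
  also have "\<dots> \<le> ?w * (?w + 1) ^ Suc j + (?w + 1) ^ Suc j"
    using 3 power_increasing[of j "Suc j" "?w + 1"]
    by (intro add_mono mult_left_mono) auto
  also have "\<dots> = (?w + 1) ^ Suc (Suc j)"
    by (simp add: algebra_simps)
  finally show ?case .
qed

text \<open>The ratio of consecutive majorants is $M |q|^{n+1}$, which tends to 0.\<close>

lemma summable_jacobi: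
  fixes q z :: complex
  assumes "norm q < 1"
  shows "summable (\<lambda>j. norm (jacobi_coeff z j * q ^ triangle j))"
proof -
  define M where "M = norm (z + 1 / z) + 1"
  have M: "M > 0"
    unfolding M_def by (simp add: add_nonneg_pos)
  have "(\<lambda>n. M * norm q ^ Suc n) \<longlonglongrightarrow> M * 0"
    using assms by (intro tendsto_intros LIMSEQ_Suc LIMSEQ_power_zero) simp
  then have "\<forall>\<^sub>F n in sequentially. M * norm q ^ Suc n < 1 / 2"
    by (rule order_tendstoD) simp
  then obtain n0 where n0: "\<And>n. n \<ge> n0 \<Longrightarrow> M * norm q ^ Suc n \<le> 1 / 2"
    unfolding eventually_sequentially by (meson less_imp_le)
  have "summable (\<lambda>j. M ^ j * norm q ^ triangle j)"
  proof (rule summable_ratio_test)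
    fix n assume "n \<ge> n0"
    have "norm (M ^ Suc n * norm q ^ triangle (Suc n)) = (M * norm q ^ Suc n) * (M ^ n * norm q ^ triangle n)"
      using M by (simp add: power_add abs_mult)
    also have "\<dots> \<le> 1 / 2 * (M ^ n * norm q ^ triangle n)"
      using M n0[OF \<open>n \<ge> n0\<close>] by (intro mult_right_mono) auto
    finally show "norm (M ^ Suc n * norm q ^ triangle (Suc n)) \<le> 1 / 2 * norm (M ^ n * norm q ^ triangle n)"
      using M by simp
  qed simp
  then show ?thesis
    by (rule summable_comparison_test')
       (auto simp: norm_mult norm_power M_def intro!: mult_right_mono norm_jacobi_coeff_le)
qed

lemma theta_quotient_tendsto:
  assumes "norm q < 1"
  shows "(\<lambda>n. qpoch (- q / z) q n * qpoch (- z * q) q n / qpoch q q (2 * n + 1))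
           \<longlonglongrightarrow> qpoch_inf (- q / z) q * qpoch_inf (- z * q) q / qpoch_inf q q"
proof (intro tendsto_intros qpoch_tendsto qpoch_inf_self_nonzero assms)
  have "filterlim (\<lambda>n::nat. 2 * n + 1) sequentially sequentially"
    by (rule filterlim_subseq) (simp add: strict_mono_def)
  then show "(\<lambda>n. qpoch q q (2 * n + 1)) \<longlonglongrightarrow> qpoch_inf q q"
    by (rule filterlim_compose[OF qpoch_tendsto[OF assms]])
qed

text \<open>Both sides of \<open>finite_jacobi\<close> are taken to the limit. Compared with the
  bilateral form, the factor $1 + 1/z$ of $(-1/z)_\<infinity>$ has been cancelled.\<close>

theorem jacobi_triple_product:
  fixes q z :: complex
  assumes q: "norm q < 1" and z: "z \<noteq> 0"
  shows "(\<Sum>j. jacobi_coeff z j * q ^ triangle j)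
           = qpoch_inf (- q / z) q * qpoch_inf (- z * q) q * qpoch_inf q q"
proof -
  have "(\<lambda>n. qpoch (- q / z) q n * qpoch (- z * q) q n / qpoch q q (2 * n + 1))
          \<longlonglongrightarrow> (\<Sum>j. jacobi_coeff z j * q ^ triangle j) / (qpoch_inf q q)\<^sup>2"
    unfolding finite_jacobi[OF q z] by (rule bailey_kernel_sum_tendsto[OF q summable_jacobi[OF q]])
  then have "(\<Sum>j. jacobi_coeff z j * q ^ triangle j) / (qpoch_inf q q)\<^sup>2
      = qpoch_inf (- q / z) q * qpoch_inf (- z * q) q / qpoch_inf q q"
    by (rule LIMSEQ_unique[OF _ theta_quotient_tendsto[OF q]])
  then show ?thesis
    using qpoch_inf_self_nonzero[OF q] by (simp add: field_simps power2_eq_square)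
qed

section \<open>Dominated convergence for the multiple sum\<close>

text \<open>This is Lebesgue's theorem for the counting measure on \<open>A\<close>, restated for
  \<open>infsum\<close>.\<close>

lemma dominated_convergence_infsum:
  fixes u :: "nat \<Rightarrow> 'a \<Rightarrow> complex" and g :: "'a \<Rightarrow> real"
  assumes g: "g summable_on A"
    and bound: "\<And>N x. x \<in> A \<Longrightarrow> norm (u N x) \<le> g x"
    and lim: "\<And>x. x \<in> A \<Longrightarrow> (\<lambda>N. u N x) \<longlonglongrightarrow> f x"
  shows "f summable_on A" and "(\<lambda>N. infsum (u N) A) \<longlonglongrightarrow> infsum f A"
proof -
  have nonneg: "g x \<ge> 0" if "x \<in> A" for x
    using bound[OF that, of 0] norm_ge_zero order_trans by blast
  have "(\<lambda>x. norm (g x)) summable_on A"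
    using g nonneg by (simp cong: summable_on_cong)
  then have int_g: "integrable (count_space A) g"
    by (simp only: abs_summable_equivalent abs_summable_on_def)
  note dom = int_g AE_I2[of "count_space A", simplified, OF lim] AE_I2[of "count_space A", simplified, OF bound]
  have int_f: "integrable (count_space A) f"
    by (rule integrable_dominated_convergence[OF _ _ dom]) auto
  have int_u: "integrable (count_space A) (u N)" for N
    by (rule integrable_dominated_convergence2[OF _ _ dom]) auto
  have "(\<lambda>N. integral\<^sup>L (count_space A) (u N)) \<longlonglongrightarrow> integral\<^sup>L (count_space A) f"
    by (rule integral_dominated_convergence[OF _ _ dom]) auto
  \<comment> \<open>Integrability here is absolute summability, under which the integral and
    \<open>infsum\<close> agree.\<close>
  moreover have "integral\<^sup>L (count_space A) h = infsum h A" if "integrable (count_space A) h" for h :: "'a \<Rightarrow> complex"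
    using infsetsum_infsum[of h A] that by (simp add: abs_summable_on_def infsetsum_def)
  ultimately show "(\<lambda>N. infsum (u N) A) \<longlonglongrightarrow> infsum f A"
    using int_f int_u by simp
  have "(\<lambda>x. norm (f x)) summable_on A"
    using int_f by (simp add: abs_summable_equivalent abs_summable_on_def)
  then show "f summable_on A"
    by (rule abs_summable_summable)
qed

text \<open>Over the full box the sum is a product of \<open>k\<close> geometric series; the
  decreasing tuples form a subset.\<close>

lemma summable_on_tuples:
  fixes x :: real
  assumes "0 \<le> x" "x < 1"
  shows "(\<lambda>n. \<Prod>i=1..k. x ^ n i) summable_on decreasing_tuples k"
proof (rule summable_on_subset_banach)
  have "Infinite_Set_Sum.abs_summable_on (\<lambda>n. \<Prod>i\<in>{1..k}. (\<lambda>_ m. x ^ m) i (n i)) ({1..k} \<rightarrow>\<^sub>E UNIV)"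
    using assms by (intro abs_summable_on_prod_PiE) (auto simp: abs_summable_on_nat_iff' summable_geometric)
  then show "(\<lambda>n. \<Prod>i=1..k. x ^ n i) summable_on ({1..k} \<rightarrow>\<^sub>E UNIV)"
    using abs_summable_equivalent abs_summable_summable by blast
  show "decreasing_tuples k \<subseteq> {1..k} \<rightarrow>\<^sub>E UNIV"
    by (auto simp: decreasing_tuples_def)
qed

text \<open>Each of the \<open>k - 1\<close> denominators costs a factor \<open>C\<close>, and
  $n_i(n_i+1) \<ge> n_i$ leaves a product of geometric terms.\<close>

lemma norm_tuple_weight_le:
  assumes q: "norm q < 1" and C: "C \<ge> 0" "\<And>n. norm (1 / qpoch q q n) \<le> C"
  shows "norm (tuple_weight q k n) \<le> C ^ (k - 1) * (\<Prod>i=1..k. norm q ^ n i)"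
proof -
  have "norm (tuple_weight q k n)
      = (\<Prod>i=1..<k. norm (1 / qpoch q q (n i - n (i + 1)))) * (\<Prod>i=1..k. norm q ^ (n i * (n i + 1)))"
    by (simp add: tuple_weight_def norm_divide norm_power prod_norm[symmetric] power_sum prod_dividef)
  also have "\<dots> \<le> (\<Prod>i=1..<k. C) * (\<Prod>i=1..k. norm q ^ n i)"
    using q C by (intro mult_mono prod_mono prod_nonneg) (auto intro!: power_decreasing)
  finally show ?thesis by simp
qed

lemma bailey_step_tendsto:
  fixes q :: complex
  assumes k: "k \<ge> 1" and q: "norm q < 1" and f: "convergent f"
  shows "(\<lambda>n. tuple_weight q k n * f (n k)) summable_on decreasing_tuples k"
    and "(\<lambda>N. (bailey_step q ^^ k) f N)
           \<longlonglongrightarrow> (\<Sum>\<^sub>\<infinity>n\<in>decreasing_tuples k. tuple_weight q k n * f (n k)) / qpoch_inf q q"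
proof -
  let ?P = "qpoch q q" and ?L = "qpoch_inf q q" and ?T = "decreasing_tuples k"
  let ?w = "\<lambda>n. tuple_weight q k n * f (n k)"
  \<comment> \<open>The cut-off is explicit because for \<open>n 1 > N\<close> truncated subtraction
    would give $(q)_0 = 1$ instead of 0.\<close>
  define u where "u N n = (if n 1 \<le> N then 1 / ?P (N - n 1) * ?w n else 0)" for N n
  obtain C where C: "C \<ge> 0" "\<And>n. norm (1 / ?P n) \<le> C"
    using inverse_qpoch_self_bounded[OF q] by metis
  obtain D where D: "D > 0" "\<And>n. norm (f n) \<le> D"
    using convergent_imp_Bseq[OF f] by (elim BseqE) blast
  define g where "g n = C * (C ^ (k - 1) * (\<Prod>i=1..k. norm q ^ n i) * D)" for n
  have "g summable_on ?T"
    unfolding g_def using q by (intro summable_on_cmult_right summable_on_cmult_left summable_on_tuples) auto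
  moreover have "norm (u N n) \<le> g n" for N n
  proof -
    have nn: "0 \<le> C ^ (k - 1) * (\<Prod>i=1..k. norm q ^ n i)"
      using C by (intro mult_nonneg_nonneg prod_nonneg) auto
    have "norm (?w n) \<le> C ^ (k - 1) * (\<Prod>i=1..k. norm q ^ n i) * D"
      unfolding norm_mult by (intro mult_mono norm_tuple_weight_le q C D nn) auto
    moreover have "norm (u N n) \<le> C * norm (?w n)"
    proof (cases "n 1 \<le> N")
      case True
      then have "norm (u N n) = norm (1 / ?P (N - n 1)) * norm (?w n)"
        by (simp only: u_def if_True norm_mult)
      also have "\<dots> \<le> C * norm (?w n)"
        by (intro mult_right_mono C) auto
      finally show ?thesis .
    qed (use C in \<open>simp add: u_def\<close>)
    ultimately show ?thesis
      unfolding g_def using C(1) by (meson mult_left_mono order_trans)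
  qed
  moreover have "(\<lambda>N. u N n) \<longlonglongrightarrow> 1 / ?L * ?w n" for n
  proof -
    have "(\<lambda>N. ?P (N - n 1)) \<longlonglongrightarrow> ?L"
      by (rule filterlim_compose[OF qpoch_tendsto[OF q] filterlim_minus_const_nat_at_top])
    then have "(\<lambda>N. 1 / ?P (N - n 1) * ?w n) \<longlonglongrightarrow> 1 / ?L * ?w n"
      by (intro tendsto_intros qpoch_inf_self_nonzero q)
    then show ?thesis
      by (rule Lim_transform_eventually)
         (use eventually_ge_at_top[of "n 1"] in eventually_elim, simp add: u_def)
  qed
  ultimately have sum: "(\<lambda>n. 1 / ?L * ?w n) summable_on ?T"
    and lim: "(\<lambda>N. infsum (u N) ?T) \<longlonglongrightarrow> (\<Sum>\<^sub>\<infinity>n\<in>?T. 1 / ?L * ?w n)"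
    using dominated_convergence_infsum[of g ?T u "\<lambda>n. 1 / ?L * ?w n"] by blast+
  show "?w summable_on ?T"
    using summable_on_cmult_right[OF sum, of ?L] qpoch_inf_self_nonzero[OF q] by simp
  have "infsum (u N) ?T = (bailey_step q ^^ k) f N" for N
  proof -
    have "infsum (u N) ?T = infsum (u N) {n \<in> ?T. n 1 \<le> N}"
      by (rule infsum_cong_neutral) (auto simp: u_def)
    also have "\<dots> = (\<Sum>n | n \<in> ?T \<and> n 1 \<le> N. u N n)"
      by (rule infsum_finite[OF finite_bounded_tuples])
    also have "\<dots> = (bailey_step q ^^ k) f N"
      unfolding bailey_step_funpow[OF k] by (rule sum.cong) (auto simp: u_def)
    finally show ?thesis .
  qed
  with lim show "(\<lambda>N. (bailey_step q ^^ k) f N) \<longlonglongrightarrow> infsum ?w ?T / ?L"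
    by (simp only: infsum_cmult_right') simp
qed

section \<open>Comparison of the two limits\<close>

theorem theorem5p1:
  fixes k :: nat and q z :: complex
  assumes "k \<ge> 1" and "norm q < 1" and "z \<noteq> 0"
  shows "((\<lambda>n. qpoch (- q / z) q (n k) * qpoch (- z * q) q (n k) * q ^ (\<Sum>i=1..k. n i * (n i + 1))
             / ((\<Prod>i=1..<k. qpoch q q (n i - n (i + 1))) * qpoch q q (2 * n k + 1)))
          has_sum
            (qpoch_inf (- (q ^ (2 * k + 1)) / z) (q ^ (2 * k + 1))
              * qpoch_inf (- z * q ^ (2 * k + 1)) (q ^ (2 * k + 1))
              * qpoch_inf (q ^ (2 * k + 1)) (q ^ (2 * k + 1))
             / qpoch_inf q q))
          (decreasing_tuples k)"
proof -
  note k = assms(1) and q = assms(2) and z = assms(3)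
  let ?L = "qpoch_inf q q" and ?T = "decreasing_tuples k"
  let ?Q = "q ^ (2 * k + 1)"
  define f where "f n = qpoch (- q / z) q n * qpoch (- z * q) q n / qpoch q q (2 * n + 1)" for n
  let ?w = "\<lambda>n. tuple_weight q k n * f (n k)"
  have Q: "norm ?Q < 1"
    using q unfolding norm_power by (subst power_less_one_iff) auto
  have "convergent f"
    unfolding f_def convergent_def using theta_quotient_tendsto[OF q] by blast
  note lim = bailey_step_tendsto[OF k q this]
  have f: "f = (\<lambda>n. \<Sum>j\<le>n. jacobi_coeff z j * q ^ triangle j * bailey_kernel q n j)"
    unfolding f_def finite_jacobi[OF q z] ..
  \<comment> \<open>The \<open>k\<close> steps contribute $k j(j+1)$, which is $2k$ times the
    triangular number; this turns the base \<open>q\<close> into $q^{2k+1}$.\<close>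
  have pow: "jacobi_coeff z j * q ^ triangle j * q ^ (k * (j * (j + 1))) = jacobi_coeff z j * ?Q ^ triangle j" for j
  proof -
    have "triangle j + k * (j * (j + 1)) = (2 * k + 1) * triangle j"
      unfolding double_triangle[symmetric] by (simp add: algebra_simps)
    then show ?thesis
      by (simp only: mult.assoc power_add[symmetric] power_mult[symmetric])
  qed
  have "(\<lambda>N. (bailey_step q ^^ k) f N) \<longlonglongrightarrow> (\<Sum>j. jacobi_coeff z j * ?Q ^ triangle j) / ?L\<^sup>2"
    unfolding f bailey_lemma[OF q] pow
    by (rule bailey_kernel_sum_tendsto[OF q summable_jacobi[OF Q]])
  \<comment> \<open>The same sequence converges to the multiple sum and to the theta series, each
    divided by its power of $(q)_\<infinity>$.\<close>
  then have "infsum ?w ?T / ?L = (\<Sum>j. jacobi_coeff z j * ?Q ^ triangle j) / ?L\<^sup>2"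
    by (rule LIMSEQ_unique[OF lim(2)])
  moreover have "x = y / ?L" if "x / ?L = y / ?L\<^sup>2" for x y
    using that qpoch_inf_self_nonzero[OF q] by (simp add: field_simps power2_eq_square)
  ultimately have "infsum ?w ?T = (\<Sum>j. jacobi_coeff z j * ?Q ^ triangle j) / ?L"
    by blast
  with has_sum_infsum[OF lim(1)]
  have "(?w has_sum (qpoch_inf (- ?Q / z) ?Q * qpoch_inf (- z * ?Q) ?Q * qpoch_inf ?Q ?Q / ?L)) ?T"
    by (simp only: jacobi_triple_product[OF Q z])
  moreover have "?w = (\<lambda>n. qpoch (- q / z) q (n k) * qpoch (- z * q) q (n k) * q ^ (\<Sum>i=1..k. n i * (n i + 1))
      / ((\<Prod>i=1..<k. qpoch q q (n i - n (i + 1))) * qpoch q q (2 * n k + 1)))"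
    by (simp only: tuple_weight_def f_def times_divide_times_eq mult_ac)
  ultimately show ?thesis
    by (simp only:)
qed

end
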